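(* There is an absolute constant $c_0>0$ with the following property. For any integer $n\ge3$ and any $R,L>0$ there exist a convex function $f$, Lipschitz continuous with constant $L$ on the Euclidean ball $B_2(R)\subset\mathbf{R}^n$ of radius $R$ centered at the origin, a random vector $\xi$, and an integrand $F(x,\xi)$ convex in $x$, such that $\mathbf{E}_\xi\{F(x,\xi)\}=f(x)$ and $\|F'(x,\xi)-f'(x)\|_2^2\le L^2$ almost surely for all $x\in B_2(R)$, and such that for every positive integer $N\le n$, with probability at least $1-e^{-1}$ there is an optimal solution $x(\xi^N)$ to the problem $$\min\Big\{f_N(x,\xi^N)=\frac1N\sum_{i=1}^NF(x,\xi_i):\ x\in B_2(R)\Big\},$$ with $\xi^N=(\xi_1,\dots,\xi_N)$ consisting of $N$ i.i.d. realizations of $\xi$, satisfying $$f(x(\xi^N))-\mathrm{Opt}\ge c_0LR .$$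
   Context: $\mathrm{Opt}=\min_{x\in B_2(R)}f(x)$. $F'(x,\xi)$ and $f'(x)$ denote (suitably selected) subgradients in $x$ of $F(\cdot,\xi)$ and of $f$ at $x$ (the functions need not be differentiable everywhere). $\|\cdot\|_2$ is the Euclidean norm. *)

theory Defs
  imports "HOL-Probability.Probability" "HOL-Library.Function_Algebras"
begin

text \<open>
  The dimension has to be quantified inside the theorem, after the absolute constant, so the
  \<open>n\<close>-dimensional space is the set of real sequences vanishing from index \<open>n\<close> on, as in
  \<^const>\<open>Euclidean_space\<close>. Pointwise scalar multiplication makes the library's \<^const>\<open>convex_on\<close>
  available for it.
\<close>

instantiation "fun" :: (type, real_vector) real_vector
begin

definition scaleR_fun_def: "r *\<^sub>R f = (\<lambda>x. r *\<^sub>R f x)"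

instance
  by standard (simp_all add: scaleR_fun_def fun_eq_iff scaleR_add_right scaleR_add_left)

end

lemma scaleR_fun_apply [simp]: "(r *\<^sub>R f) x = r *\<^sub>R f x"
  by (simp add: scaleR_fun_def)

abbreviation Rn :: "nat \<Rightarrow> (nat \<Rightarrow> real) set" where
  "Rn n \<equiv> topspace (Euclidean_space n)"

text \<open>
  The metric that the library puts on \<^typ>\<open>nat \<Rightarrow> real\<close> is not Euclidean, hence
  the explicit norm and the explicit Lipschitz condition below.
\<close>

definition norm2 :: "nat \<Rightarrow> (nat \<Rightarrow> real) \<Rightarrow> real" where
  "norm2 n x = L2_set x {..<n}"

definition B2 :: "nat \<Rightarrow> real \<Rightarrow> (nat \<Rightarrow> real) set" where
  "B2 n R = {x \<in> Rn n. norm2 n x \<le> R}"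

definition lipschitz2_on :: "nat \<Rightarrow> real \<Rightarrow> (nat \<Rightarrow> real) set \<Rightarrow> ((nat \<Rightarrow> real) \<Rightarrow> real) \<Rightarrow> bool" where
  "lipschitz2_on n L S f \<longleftrightarrow> (\<forall>x\<in>S. \<forall>y\<in>S. \<bar>f x - f y\<bar> \<le> L * norm2 n (x - y))"

definition is_subgradient ::
  "nat \<Rightarrow> ((nat \<Rightarrow> real) \<Rightarrow> real) \<Rightarrow> (nat \<Rightarrow> real) \<Rightarrow> (nat \<Rightarrow> real) \<Rightarrow> bool" where
  "is_subgradient n f x g \<longleftrightarrow>
     g \<in> Rn n \<and> (\<forall>y\<in>Rn n. f y \<ge> f x + (\<Sum>i<n. g i * (y i - x i)))"

text \<open>A random vector in \<open>m\<close>-dimensional space enters through its law, a Borel probability measure.\<close>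

definition vector_law :: "nat \<Rightarrow> (nat \<Rightarrow> real) measure \<Rightarrow> bool" where
  "vector_law m P \<longleftrightarrow> prob_space P \<and> sets P = sets (restrict_space borel (Rn m))"

text \<open>The sample \<open>\<xi>\<^sub>1, \<dots>, \<xi>\<^sub>N\<close> is indexed from \<open>0\<close>.\<close>

definition sample_average ::
  "('a \<Rightarrow> 'b \<Rightarrow> real) \<Rightarrow> nat \<Rightarrow> (nat \<Rightarrow> 'b) \<Rightarrow> 'a \<Rightarrow> real" where
  "sample_average F N \<xi>s x = (1 / real N) * (\<Sum>i<N. F x (\<xi>s i))"

end

theory Submission
  imports Defs
begin

text \<open>
  Let \<open>\<xi>\<close> be uniform on the scenarios \<open>0, \<dots>, 2n - 1\<close>. Attach to every set \<open>T\<close> of at most \<open>n\<close>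
  scenarios a unit vector \<open>v\<^sub>T\<close> such that distinct vectors have inner product at most an absolute
  constant \<open>\<gamma> < 1\<close>, and put
  \<open>F(x, \<omega>) = L/2 \<cdot> max (\<gamma> R) (max {\<langle>v\<^sub>T, x\<rangle> | \<omega> \<notin> T})\<close>.
  A sample of size \<open>N \<le> n\<close> sees only a set \<open>S\<close> of at most \<open>n\<close> scenarios, and the point
  \<open>x = R v\<^sub>S\<close> is invisible to it: in a scenario \<open>\<omega> \<in> S\<close> the vector \<open>v\<^sub>S\<close> is left out of the
  maximum, while all other vectors contribute at most \<open>\<gamma> R\<close>. So \<open>x\<close> attains the floor
  \<open>L \<gamma> R / 2\<close> of every sampled integrand and minimises the sample average. At least half of the
  scenarios lie outside \<open>S\<close>, however, and there the integrand is \<open>L R / 2\<close> at \<open>x\<close>. Since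
  the floor is attained by \<open>f\<close> at the origin, \<open>x\<close> is suboptimal by at least
  \<open>(1 - \<gamma>) L R / 4\<close>. This happens for every sample, so the probability in question is \<open>1\<close>.

  Everything rests on having that many vectors in dimension \<open>n\<close>: at most \<open>2\<^sup>2\<^sup>n = 4\<^sup>n\<close> are wanted
  (\<open>spherical_code\<close>). Group the coordinates into \<open>m = n div 2\<close> planes and let a word of length \<open>m\<close>
  over an alphabet of \<open>q\<close> points on a circular arc choose one point in each plane. All these
  vectors have the same length, and two words that agree in fewer than half of the positions give
  an inner product bounded away from \<open>1\<close>. The Gilbert--Varshamov argument produces about
  \<open>(\<surd>q / 2)\<^sup>m\<close> such words, and an absolute constant \<open>q\<close> makes this at least \<open>4\<^sup>n\<close> for all \<open>n \<ge> 2\<close>,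
  so small dimensions need no separate treatment.

  The subgradients of the integrands have norm at most \<open>L / 2\<close>, which gives the bound \<open>L\<close> on the
  noise, and convexity and the Lipschitz property follow from subgradients existing everywhere.
\<close>

section \<open>Greedy packings and words with few agreements\<close>

text \<open>
  As long as the balls of at most \<open>b\<close> points around the chosen points do not exhaust \<open>X\<close>, one more point
  can be chosen.
\<close>

lemma greedy_packing:
  assumes "finite X" and "b > 0"
    and ball: "\<And>x. x \<in> X \<Longrightarrow> card {y \<in> X. near x y} \<le> b"
    and refl: "\<And>x. x \<in> X \<Longrightarrow> near x x"
    and sym: "\<And>x y. near x y \<Longrightarrow> near y x"
    and "k * b \<le> card X"
  shows "\<exists>C. C \<subseteq> X \<and> card C = k \<and> (\<forall>x\<in>C. \<forall>y\<in>C. x \<noteq> y \<longrightarrow> \<not> near x y)"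
  using \<open>k * b \<le> card X\<close>
proof (induction k)
  case 0
  show ?case by (rule exI[of _ "{}"]) simp
next
  case (Suc k)
  then obtain C where C: "C \<subseteq> X" "card C = k" "\<forall>x\<in>C. \<forall>y\<in>C. x \<noteq> y \<longrightarrow> \<not> near x y"
    by auto
  have fin: "finite C" using C(1) \<open>finite X\<close> finite_subset by blast
  have "card (\<Union>x\<in>C. {y \<in> X. near x y}) \<le> (\<Sum>x\<in>C. card {y \<in> X. near x y})"
    by (rule card_UN_le[OF fin])
  also have "\<dots> \<le> (\<Sum>x\<in>C. b)" using C(1) by (intro sum_mono ball) auto
  also have "\<dots> < card X" using C(2) Suc.prems \<open>b > 0\<close> by simp
  finally have "\<not> X \<subseteq> (\<Union>x\<in>C. {y \<in> X. near x y})"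
    by (metis (no_types, lifting) \<open>finite X\<close> UN_least card_mono finite_subset leD mem_Collect_eq subsetI)
  then obtain y where y: "y \<in> X" "\<And>x. x \<in> C \<Longrightarrow> \<not> near x y" by auto
  have "y \<notin> C" using y refl by auto
  moreover have "\<forall>x\<in>insert y C. \<forall>z\<in>insert y C. x \<noteq> z \<longrightarrow> \<not> near x z"
    using C(3) y sym by blast
  ultimately show ?case using C y fin by (intro exI[of _ "insert y C"]) auto
qed

text \<open>
  A Hamming ball of radius half the length. With an alphabet of \<open>r\<^sup>2\<close> letters, prescribing at least
  half of the letters leaves at most \<open>(r\<^sup>2)\<^sup>m\<^sup>/\<^sup>2 = r\<^sup>m\<close> words, and there are at most \<open>2\<^sup>m\<close> choices for the
  set of prescribed positions.
\<close>

lemma card_words_agreeing_le: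
  fixes m r :: nat
  defines "W \<equiv> {..<m} \<rightarrow>\<^sub>E {..<r\<^sup>2}"
  assumes "r > 0" "x \<in> W"
  shows "card {y \<in> W. m \<le> 2 * card {j \<in> {..<m}. x j = y j}} \<le> (2 * r) ^ m"
proof -
  define \<A> where "\<A> = {A \<in> Pow {..<m}. m \<le> 2 * card A}"
  define cyl where "cyl A = (\<Pi>\<^sub>E j\<in>{..<m}. if j \<in> A then {x j} else {..<r\<^sup>2})" for A
  have fin: "finite \<A>" by (simp add: \<A>_def)
  have card_cyl: "card (cyl A) \<le> r ^ m" if "A \<in> \<A>" for A
  proof -
    have A: "A \<subseteq> {..<m}" "m \<le> 2 * card A" using that by (auto simp: \<A>_def)
    have "card (cyl A) = (\<Prod>j<m. if j \<in> A then 1 else r\<^sup>2)"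
      unfolding cyl_def by (subst card_PiE) (auto intro: prod.cong)
    also have "\<dots> = (r\<^sup>2) ^ card ({..<m} - A)"
      by (subst prod.If_cases) (auto simp: Diff_eq)
    also have "\<dots> = r ^ (2 * (m - card A))"
      using A by (simp add: card_Diff_subset finite_subset power_mult)
    also have "\<dots> \<le> r ^ m" using A \<open>r > 0\<close> by (intro power_increasing) auto
    finally show ?thesis .
  qed
  have "{y \<in> W. m \<le> 2 * card {j \<in> {..<m}. x j = y j}} \<subseteq> (\<Union>A\<in>\<A>. cyl A)"
  proof
    fix y assume y: "y \<in> {y \<in> W. m \<le> 2 * card {j \<in> {..<m}. x j = y j}}"
    have "{j \<in> {..<m}. x j = y j} \<in> \<A>" using y by (auto simp: \<A>_def)
    moreover have "y \<in> cyl {j \<in> {..<m}. x j = y j}"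
      using y by (auto simp: cyl_def W_def PiE_iff)
    ultimately show "y \<in> (\<Union>A\<in>\<A>. cyl A)" by blast
  qed
  moreover have "finite (\<Union>A\<in>\<A>. cyl A)"
    using fin by (auto simp: cyl_def intro!: finite_PiE)
  ultimately have "card {y \<in> W. m \<le> 2 * card {j \<in> {..<m}. x j = y j}} \<le> card (\<Union>A\<in>\<A>. cyl A)"
    by (rule card_mono[rotated])
  also have "\<dots> \<le> (\<Sum>A\<in>\<A>. card (cyl A))" by (rule card_UN_le[OF fin])
  also have "\<dots> \<le> card \<A> * r ^ m"
    using sum_bounded_above[of \<A> "\<lambda>A. card (cyl A)"] card_cyl by simp
  also have "\<dots> \<le> 2 ^ m * r ^ m"
    using card_mono[of "Pow {..<m}" \<A>] by (intro mult_right_mono) (auto simp: \<A>_def card_Pow)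
  finally show ?thesis by (simp add: power_mult_distrib)
qed

lemma words_with_few_agreements:
  fixes m r :: nat
  assumes "r > 0" and "k * (2 * r) ^ m \<le> (r\<^sup>2) ^ m"
  shows "\<exists>C \<subseteq> {..<m} \<rightarrow>\<^sub>E {..<r\<^sup>2}. card C = k \<and>
           (\<forall>x\<in>C. \<forall>y\<in>C. x \<noteq> y \<longrightarrow> 2 * card {j \<in> {..<m}. x j = y j} < m)"
proof -
  let ?W = "{..<m} \<rightarrow>\<^sub>E {..<r\<^sup>2}"
  have "\<exists>C. C \<subseteq> ?W \<and> card C = k \<and>
      (\<forall>x\<in>C. \<forall>y\<in>C. x \<noteq> y \<longrightarrow> \<not> m \<le> 2 * card {j \<in> {..<m}. x j = y j})"
  proof (rule greedy_packing)
    show "finite ?W" by (auto intro: finite_PiE)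
    show "card {y \<in> ?W. m \<le> 2 * card {j \<in> {..<m}. x j = y j}} \<le> (2 * r) ^ m" if "x \<in> ?W" for x
      using card_words_agreeing_le[OF \<open>r > 0\<close> that] .
    show "k * (2 * r) ^ m \<le> card ?W" using assms(2) by (simp add: card_PiE)
    show "m \<le> 2 * card {j \<in> {..<m}. y j = x j}" if "m \<le> 2 * card {j \<in> {..<m}. x j = y j}" for x y
      using that by (simp add: eq_commute)
  qed (use \<open>r > 0\<close> in auto)
  then show ?thesis by (simp add: not_le)
qed

section \<open>Exponentially large spherical codes\<close>

definition dot :: "nat \<Rightarrow> (nat \<Rightarrow> real) \<Rightarrow> (nat \<Rightarrow> real) \<Rightarrow> real" where
  "dot n x y = (\<Sum>i<n. x i * y i)"

text \<open>
  The bound \<open>\<gamma>\<close> on the inner products. Letters are the angles \<open>0, 1/q, \<dots>, (q - 1)/q\<close> for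
  \<open>q = 16384\<close>; positions with different letters contribute at most \<open>cos (1/q)\<close>, and fewer than
  half of the positions contribute \<open>1\<close>.
\<close>

definition overlap :: real where
  "overlap = (1 + cos (1 / 16384)) / 2"

lemma overlap_bounds: "0 < overlap" "overlap < 1"
proof -
  have "cos (1 / 16384) < cos (0::real)"
    using pi_gt3 by (intro cos_monotone_0_pi) auto
  then show "overlap < 1" by (simp add: overlap_def)
  have "cos (1 / 16384 :: real) > 0"
    using pi_gt3 by (intro cos_gt_zero) auto
  then show "0 < overlap" by (simp add: overlap_def)
qed

text \<open>
  The coordinates \<open>2j\<close> and \<open>2j + 1\<close> form the plane that holds the letter \<open>w j\<close>; for odd \<open>n\<close>
  the last coordinate stays \<open>0\<close>.
\<close>

definition arc_word :: "nat \<Rightarrow> (nat \<Rightarrow> nat) \<Rightarrow> nat \<Rightarrow> real" where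
  "arc_word m w i =
     (if i < 2 * m
      then (if even i then cos (real (w (i div 2)) / 16384) else sin (real (w (i div 2)) / 16384)) / sqrt m
      else 0)"

lemma arc_word_in_Rn: "2 * m \<le> n \<Longrightarrow> arc_word m w \<in> Rn n"
  by (simp add: topspace_Euclidean_space arc_word_def)

lemma dot_arc_word:
  assumes "2 * m \<le> n" "m > 0"
  shows "dot n (arc_word m w) (arc_word m w')
           = (\<Sum>j<m. cos ((real (w j) - real (w' j)) / 16384)) / m"
proof -
  let ?p = "\<lambda>i. arc_word m w i * arc_word m w' i"
  have pairs: "(\<Sum>i<2 * k. h i) = (\<Sum>j<k. h (2 * j) + h (2 * j + 1))"
    for h :: "nat \<Rightarrow> real" and k
    by (induction k) auto
  have "dot n (arc_word m w) (arc_word m w') = (\<Sum>i<2 * m. ?p i)"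
    unfolding dot_def using assms
    by (intro sum.mono_neutral_right) (auto simp: arc_word_def)
  also have "\<dots> = (\<Sum>j<m. ?p (2 * j) + ?p (2 * j + 1))" by (rule pairs)
  also have "\<dots> = (\<Sum>j<m. cos ((real (w j) - real (w' j)) / 16384) / m)"
  proof (rule sum.cong[OF refl])
    fix j assume "j \<in> {..<m}"
    then have j: "2 * j < 2 * m" "2 * j + 1 < 2 * m" by auto
    have s: "sqrt m * sqrt m = m" by simp
    show "?p (2 * j) + ?p (2 * j + 1) = cos ((real (w j) - real (w' j)) / 16384) / m"
      using j s by (simp add: arc_word_def diff_divide_distrib cos_diff add_divide_distrib)
  qed
  finally show ?thesis by (simp add: sum_divide_distrib)
qed

lemma dot_arc_word_le_overlap:
  assumes "2 * m \<le> n" "m > 0"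
    and w: "w \<in> {..<m} \<rightarrow>\<^sub>E {..<16384}" "w' \<in> {..<m} \<rightarrow>\<^sub>E {..<16384}"
    and few: "2 * card {j \<in> {..<m}. w j = w' j} < m"
  shows "dot n (arc_word m w) (arc_word m w') \<le> overlap"
proof -
  let ?c = "cos (1 / 16384 :: real)"
  let ?A = "{j \<in> {..<m}. w j = w' j}"
  have letter: "cos ((real (w j) - real (w' j)) / 16384) \<le> ?c + (if w j = w' j then 1 - ?c else 0)"
    if "j < m" for j
  proof (cases "w j = w' j")
    case False
    have b: "w j < 16384" "w' j < 16384" using w that by auto
    let ?d = "\<bar>(real (w j) - real (w' j)) / 16384\<bar>"
    have "1 \<le> \<bar>real (w j) - real (w' j)\<bar>" using False by linarith
    then have "1 / 16384 \<le> ?d" by simp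
    moreover have "?d \<le> pi" using b pi_gt3 by (simp add: abs_le_iff)
    ultimately have "cos ?d \<le> ?c" by (intro cos_monotone_0_pi_le) auto
    then show ?thesis using False by (simp only: cos_abs_real) simp
  qed simp
  have "(\<Sum>j<m. cos ((real (w j) - real (w' j)) / 16384))
          \<le> (\<Sum>j<m. ?c + (if w j = w' j then 1 - ?c else 0))"
    by (intro sum_mono letter) auto
  also have "\<dots> = m * ?c + real (card ?A) * (1 - ?c)"
    by (simp add: sum.distrib flip: sum.inter_filter)
  also have "\<dots> \<le> m * ?c + (real m / 2) * (1 - ?c)"
    using few by (intro add_left_mono mult_right_mono) auto
  also have "\<dots> = m * overlap" by (simp add: overlap_def field_simps)
  finally show ?thesis
    using \<open>m > 0\<close> by (simp add: dot_arc_word[OF assms(1,2)] divide_le_eq mult.commute)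
qed

text \<open>
  The alphabet size \<open>q = 128\<^sup>2\<close> comes from here: \<open>n \<le> 3m\<close> gives \<open>4\<^sup>n \<le> 64\<^sup>m\<close>, and the greedy packing
  needs \<open>64\<^sup>m\<close> times the ball size \<open>(2 \<surd>q)\<^sup>m\<close> to be at most the number \<open>q\<^sup>m\<close> of words, that is
  \<open>\<surd>q \<ge> 128\<close>.
\<close>

lemma spherical_code:
  assumes "n \<ge> 2" "finite I" "card I \<le> 4 ^ n"
  shows "\<exists>v. \<forall>T\<in>I. v T \<in> Rn n \<and> dot n (v T) (v T) = 1 \<and>
           (\<forall>T'\<in>I. T \<noteq> T' \<longrightarrow> dot n (v T) (v T') \<le> overlap)"
proof -
  define m where "m = n div 2"
  have m: "m > 0" "2 * m \<le> n" "n \<le> 3 * m" using \<open>n \<ge> 2\<close> by (auto simp: m_def)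
  have "card I \<le> 4 ^ (3 * m)"
    using assms(3) m(3) by (meson le_trans one_le_numeral power_increasing)
  then have "card I * (2 * 128) ^ m \<le> 4 ^ (3 * m) * (2 * 128) ^ m" by (rule mult_right_mono) simp
  also have "\<dots> = ((128::nat)\<^sup>2) ^ m"
    by (simp add: power_mult flip: power_mult_distrib)
  finally have "card I * (2 * 128) ^ m \<le> (128\<^sup>2) ^ m" .
  then obtain C where C: "C \<subseteq> {..<m} \<rightarrow>\<^sub>E {..<(128::nat)\<^sup>2}" "card C = card I"
    "\<And>x y. x \<in> C \<Longrightarrow> y \<in> C \<Longrightarrow> x \<noteq> y \<Longrightarrow> 2 * card {j \<in> {..<m}. x j = y j} < m"
    using words_with_few_agreements[of 128 "card I" m] by auto
  have "finite C" using C(1) by (rule finite_subset) (auto intro: finite_PiE)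
  then obtain h where h: "bij_betw h I C"
    using finite_same_card_bij[of I C] \<open>finite I\<close> C(2) by auto
  have "arc_word m (h T) \<in> Rn n \<and> dot n (arc_word m (h T)) (arc_word m (h T)) = 1 \<and>
      (\<forall>T'\<in>I. T \<noteq> T' \<longrightarrow> dot n (arc_word m (h T)) (arc_word m (h T')) \<le> overlap)"
    if T: "T \<in> I" for T
  proof (intro conjI ballI impI)
    show "arc_word m (h T) \<in> Rn n" using m by (simp add: arc_word_in_Rn)
    show "dot n (arc_word m (h T)) (arc_word m (h T)) = 1"
      using m by (simp add: dot_arc_word)
    fix T' assume T': "T' \<in> I" "T \<noteq> T'"
    have "h T \<in> C" "h T' \<in> C" "h T \<noteq> h T'"
      using h T T' by (auto simp: bij_betw_def inj_on_def)
    with C m show "dot n (arc_word m (h T)) (arc_word m (h T')) \<le> overlap"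
      by (intro dot_arc_word_le_overlap) auto
  qed
  then show ?thesis by (intro exI[of _ "\<lambda>T. arc_word m (h T)"]) blast
qed

section \<open>Convexity and Lipschitz continuity from bounded subgradients\<close>

lemma norm2_power2: "(norm2 n x)\<^sup>2 = dot n x x"
  by (simp add: norm2_def L2_set_def dot_def power2_eq_square sum_nonneg)

lemma norm2_nonneg: "0 \<le> norm2 n x"
  by (simp add: norm2_def)

lemma norm2_scale: "norm2 n (\<lambda>i. c * x i) = \<bar>c\<bar> * norm2 n x"
  using L2_set_right_distrib[of "\<bar>c\<bar>" x "{..<n}"]
  by (simp add: norm2_def L2_set_def power_mult_distrib)

lemma norm2_minus_commute: "norm2 n (x - y) = norm2 n (y - x)"
  by (simp add: norm2_def L2_set_def power2_commute)

lemma norm2_diff_le: "norm2 n (x - y) \<le> norm2 n x + norm2 n y"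
proof -
  have "norm2 n (x - y) \<le> norm2 n x + norm2 n (\<lambda>i. (-1) * y i)"
    using L2_set_triangle_ineq[of x "\<lambda>i. (-1) * y i" "{..<n}"]
    by (simp add: norm2_def fun_diff_def)
  then show ?thesis by (simp only: norm2_scale)
qed

lemma norm2_sum_le: "norm2 n (\<lambda>i. \<Sum>\<omega>\<in>A. g \<omega> i) \<le> (\<Sum>\<omega>\<in>A. norm2 n (g \<omega>))"
proof (induction A rule: infinite_finite_induct)
  case (insert a A)
  have "norm2 n (\<lambda>i. g a i + (\<Sum>\<omega>\<in>A. g \<omega> i)) \<le> norm2 n (g a) + norm2 n (\<lambda>i. \<Sum>\<omega>\<in>A. g \<omega> i)"
    unfolding norm2_def by (rule L2_set_triangle_ineq)
  with insert show ?case by simp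
qed (simp_all add: norm2_def L2_set_def)

lemma dot_le_norm2: "dot n x y \<le> norm2 n x * norm2 n y"
proof -
  have "dot n x y \<le> (\<Sum>i<n. \<bar>x i\<bar> * \<bar>y i\<bar>)"
    unfolding dot_def by (intro sum_mono) (simp flip: abs_mult)
  also have "\<dots> \<le> norm2 n x * norm2 n y"
    unfolding norm2_def by (rule L2_set_mult_ineq)
  finally show ?thesis .
qed

lemma is_subgradient_iff_dot:
  "is_subgradient n f x g \<longleftrightarrow> g \<in> Rn n \<and> (\<forall>y\<in>Rn n. f y \<ge> f x + dot n g (y - x))"
  by (simp add: is_subgradient_def dot_def)

text \<open>
  The subgradient inequality at the convex combination \<open>z\<close>, averaged over the two end points:
  the linear terms cancel.
\<close>

lemma convex_on_if_subgradients:
  assumes "\<And>x. x \<in> Rn n \<Longrightarrow> \<exists>g. is_subgradient n f x g"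
  shows "convex_on (Rn n) f"
proof -
  have conv: "convex (Rn n)"
    by (auto simp: convex_def topspace_Euclidean_space)
  moreover have "f (u *\<^sub>R x + w *\<^sub>R y) \<le> u * f x + w * f y"
    if "x \<in> Rn n" "y \<in> Rn n" "u \<ge> 0" "w \<ge> 0" "u + w = 1" for x y u w
  proof -
    define z where "z = u *\<^sub>R x + w *\<^sub>R y"
    have "z \<in> Rn n" unfolding z_def using conv that by (auto simp: convex_def)
    then obtain g where g: "is_subgradient n f z g" using assms by blast
    have "u * (f z + dot n g (x - z)) + w * (f z + dot n g (y - z)) \<le> u * f x + w * f y"
      using g that by (intro add_mono mult_left_mono) (auto simp: is_subgradient_iff_dot)
    moreover have "u * dot n g (x - z) + w * dot n g (y - z) = 0"
    proof -
      have "u * (g i * (x i - z i)) + w * (g i * (y i - z i)) = 0" for i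
      proof -
        have "u * (g i * (x i - z i)) + w * (g i * (y i - z i))
            = g i * (u * x i + w * y i - (u + w) * z i)" by (simp add: algebra_simps)
        also have "\<dots> = 0" using that by (simp add: z_def)
        finally show ?thesis .
      qed
      then show ?thesis
        by (simp add: dot_def sum_distrib_left flip: sum.distrib)
    qed
    moreover have "u * f z + w * f z = f z" using that by (simp flip: distrib_right)
    ultimately show ?thesis by (simp add: z_def algebra_simps)
  qed
  ultimately show ?thesis by (auto simp: convex_on_def)
qed

lemma lipschitz2_on_if_subgradients:
  assumes "S \<subseteq> Rn n"
    and "\<And>x. x \<in> Rn n \<Longrightarrow> \<exists>g. is_subgradient n f x g \<and> norm2 n g \<le> K"
  shows "lipschitz2_on n K S f"
proof -
  have "f x - f y \<le> K * norm2 n (x - y)" if "x \<in> S" "y \<in> S" for x y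
  proof -
    obtain g where g: "is_subgradient n f x g" "norm2 n g \<le> K"
      using assms \<open>x \<in> S\<close> by blast
    have "f x - f y \<le> - dot n g (y - x)"
      using g(1) assms(1) \<open>y \<in> S\<close> by (force simp: is_subgradient_iff_dot)
    also have "\<dots> = dot n g (x - y)" by (simp add: dot_def algebra_simps flip: sum_negf)
    also have "\<dots> \<le> norm2 n g * norm2 n (x - y)" by (rule dot_le_norm2)
    also have "\<dots> \<le> K * norm2 n (x - y)" using g(2) norm2_nonneg by (rule mult_right_mono)
    finally show ?thesis .
  qed
  then show ?thesis
    by (auto simp: lipschitz2_on_def abs_le_iff) (metis norm2_minus_commute)
qed

lemma is_subgradient_average:
  assumes "\<And>\<omega>. \<omega> < k \<Longrightarrow> is_subgradient n (G \<omega>) x (g \<omega>)"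
  shows "is_subgradient n (\<lambda>y. (\<Sum>\<omega><k. G \<omega> y) / real k) x (\<lambda>i. (\<Sum>\<omega><k. g \<omega> i) / real k)"
  unfolding is_subgradient_def
proof (intro conjI ballI)
  show "(\<lambda>i. (\<Sum>\<omega><k. g \<omega> i) / real k) \<in> Rn n"
    using assms by (auto simp: is_subgradient_def topspace_Euclidean_space)
  fix y assume "y \<in> Rn n"
  have "(\<Sum>\<omega><k. G \<omega> x) + (\<Sum>\<omega><k. \<Sum>i<n. g \<omega> i * (y i - x i)) \<le> (\<Sum>\<omega><k. G \<omega> y)"
    using assms \<open>y \<in> Rn n\<close> by (auto simp: is_subgradient_def simp flip: sum.distrib intro!: sum_mono)
  then have "((\<Sum>\<omega><k. G \<omega> x) + (\<Sum>\<omega><k. \<Sum>i<n. g \<omega> i * (y i - x i))) / real k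
      \<le> (\<Sum>\<omega><k. G \<omega> y) / real k" by (rule divide_right_mono) simp
  moreover have "(\<Sum>i<n. (\<Sum>\<omega><k. g \<omega> i) / real k * (y i - x i))
      = (\<Sum>\<omega><k. \<Sum>i<n. g \<omega> i * (y i - x i)) / real k"
    by (subst sum.swap) (simp add: sum_distrib_right sum_divide_distrib)
  ultimately show "(\<Sum>\<omega><k. G \<omega> x) / real k + (\<Sum>i<n. (\<Sum>\<omega><k. g \<omega> i) / real k * (y i - x i))
      \<le> (\<Sum>\<omega><k. G \<omega> y) / real k" by (simp add: add_divide_distrib)
qed

lemma norm2_average_le:
  assumes "k > 0" and "\<And>\<omega>. \<omega> < k \<Longrightarrow> norm2 n (g \<omega>) \<le> K"
  shows "norm2 n (\<lambda>i. (\<Sum>\<omega><k. g \<omega> i) / real k) \<le> K"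
proof -
  have "norm2 n (\<lambda>i. (1 / real k) * (\<Sum>\<omega><k. g \<omega> i)) = (1 / real k) * norm2 n (\<lambda>i. \<Sum>\<omega><k. g \<omega> i)"
    by (subst norm2_scale) simp
  also have "\<dots> \<le> (1 / real k) * (\<Sum>\<omega><k. norm2 n (g \<omega>))"
    by (intro mult_left_mono norm2_sum_le) simp
  also have "\<dots> \<le> (1 / real k) * (real k * K)"
    using assms(2) sum_bounded_above[of "{..<k}" "\<lambda>\<omega>. norm2 n (g \<omega>)" K]
    by (intro mult_left_mono) auto
  finally show ?thesis using \<open>k > 0\<close> by simp
qed

section \<open>Finitely many equally likely scenarios\<close>

text \<open>
  Scenario \<open>\<omega>\<close> is realised as the point \<open>\<omega>\<close> of the one-dimensional space. The inverse map
  \<open>scenario\<close> is extended to the whole space with values below \<open>k\<close>, so that statements about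
  the integrand hold for every realisation and not merely almost surely.
\<close>

definition scenario_law :: "nat \<Rightarrow> (nat \<Rightarrow> real) measure" where
  "scenario_law k = distr (measure_pmf (pmf_of_set {..<k})) (restrict_space borel (Rn 1))
     (\<lambda>\<omega> i. if i = 0 then real \<omega> else 0)"

definition scenario :: "nat \<Rightarrow> (nat \<Rightarrow> real) \<Rightarrow> nat" where
  "scenario k \<xi> = nat \<lfloor>\<xi> 0\<rfloor> mod k"

lemma scenario_less: "k > 0 \<Longrightarrow> scenario k \<xi> < k"
  by (simp add: scenario_def)

lemma embed_scenario_measurable:
  "(\<lambda>\<omega> i. if i = 0 then real \<omega> else 0) \<in>
     measurable (measure_pmf p) (restrict_space borel (Rn 1))"
  by (auto simp: space_restrict_space topspace_Euclidean_space)

lemma vector_law_scenario_law: "vector_law 1 (scenario_law k)"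
  unfolding vector_law_def scenario_law_def
  by (intro conjI measure_pmf.prob_space_distr embed_scenario_measurable) simp

lemma scenario_function_measurable:
  "(\<lambda>\<xi>. h (scenario k \<xi>)) \<in> borel_measurable (restrict_space borel (Rn 1))"
proof -
  have "(\<lambda>\<xi>::nat \<Rightarrow> real. \<xi> 0) \<in> borel_measurable borel"
    by (intro borel_measurable_continuous_onI continuous_on_product_coordinates)
  then have [measurable]: "(\<lambda>\<xi>::nat \<Rightarrow> real. \<xi> 0) \<in> borel_measurable (restrict_space borel (Rn 1))"
    by (rule measurable_restrict_space1)
  have "(\<lambda>\<xi>. (\<lambda>z::int. h (nat z mod k)) \<lfloor>\<xi> 0\<rfloor>) \<in> borel_measurable (restrict_space borel (Rn 1))"
    by measurable
  then show ?thesis by (simp add: scenario_def)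
qed

lemma
  assumes "k > 0"
  shows integrable_scenario_law: "integrable (scenario_law k) (\<lambda>\<xi>. h (scenario k \<xi>) :: real)"
    and integral_scenario_law:
      "(\<integral>\<xi>. h (scenario k \<xi>) \<partial>scenario_law k) = (\<Sum>\<omega><k. h \<omega>) / real k"
proof -
  have ne: "{..<k} \<noteq> {}" using assms by auto
  show "integrable (scenario_law k) (\<lambda>\<xi>. h (scenario k \<xi>) :: real)"
    unfolding scenario_law_def
    by (subst integrable_distr_eq[OF embed_scenario_measurable scenario_function_measurable])
      (rule integrable_measure_pmf_finite, use ne in simp)
  have "(\<integral>\<xi>. h (scenario k \<xi>) \<partial>scenario_law k)
      = (\<integral>\<omega>. h (\<omega> mod k) \<partial>measure_pmf (pmf_of_set {..<k}))"
    unfolding scenario_law_def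
    by (subst integral_distr[OF embed_scenario_measurable scenario_function_measurable])
      (simp add: scenario_def)
  also have "\<dots> = (\<Sum>\<omega><k. h \<omega>) / real k"
    using ne by (subst integral_pmf_of_set) auto
  finally show "(\<integral>\<xi>. h (scenario k \<xi>) \<partial>scenario_law k) = (\<Sum>\<omega><k. h \<omega>) / real k" .
qed


section \<open>A floored maximum of linear functions over part of the code\<close>

definition floored_max :: "nat \<Rightarrow> real \<Rightarrow> (nat \<Rightarrow> real) set \<Rightarrow> (nat \<Rightarrow> real) \<Rightarrow> real" where
  "floored_max n a V x = Max (insert a ((\<lambda>v. dot n v x) ` V))"

lemma floored_max_ge:
  assumes "finite V"
  shows "a \<le> floored_max n a V x" "v \<in> V \<Longrightarrow> dot n v x \<le> floored_max n a V x"
  using assms by (auto simp: floored_max_def)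

lemma floored_max_eq_floor:
  assumes "finite V" "\<And>v. v \<in> V \<Longrightarrow> dot n v x \<le> a"
  shows "floored_max n a V x = a"
  using assms unfolding floored_max_def by (intro Max_eqI) auto

lemma floored_max_subgradient:
  assumes "finite V" "K \<ge> 0" and V: "\<And>v. v \<in> V \<Longrightarrow> v \<in> Rn n \<and> norm2 n v \<le> 1"
  shows "\<exists>g. is_subgradient n (\<lambda>y. K * floored_max n a V y) x g \<and> norm2 n g \<le> K"
proof -
  have "floored_max n a V x \<in> insert a ((\<lambda>v. dot n v x) ` V)"
    unfolding floored_max_def using \<open>finite V\<close> by (intro Max_in) auto
  then consider "floored_max n a V x = a" | v where "v \<in> V" "floored_max n a V x = dot n v x"
    by auto
  then show ?thesis
  proof cases
    case 1
    have "is_subgradient n (\<lambda>y. K * floored_max n a V y) x (\<lambda>i. 0)"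
      using 1 floored_max_ge(1)[OF \<open>finite V\<close>] \<open>K \<ge> 0\<close>
      by (auto simp: is_subgradient_def topspace_Euclidean_space intro: mult_left_mono)
    then show ?thesis using \<open>K \<ge> 0\<close> by (intro exI[of _ "\<lambda>i. 0"]) (simp add: norm2_def L2_set_def)
  next
    case (2 v)
    have "is_subgradient n (\<lambda>y. K * floored_max n a V y) x (\<lambda>i. K * v i)"
      unfolding is_subgradient_iff_dot
    proof (intro conjI ballI)
      show "(\<lambda>i. K * v i) \<in> Rn n" using V[OF 2(1)] by (auto simp: topspace_Euclidean_space)
      fix y
      have "K * dot n v x + dot n (\<lambda>i. K * v i) (y - x) = K * dot n v y"
        by (simp add: dot_def sum_distrib_left algebra_simps flip: sum.distrib)
      also have "\<dots> \<le> K * floored_max n a V y"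
        using floored_max_ge(2)[OF \<open>finite V\<close> 2(1)] \<open>K \<ge> 0\<close> by (rule mult_left_mono)
      finally show "K * floored_max n a V x + dot n (\<lambda>i. K * v i) (y - x) \<le> K * floored_max n a V y"
        using 2(2) by simp
    qed
    moreover have "norm2 n (\<lambda>i. K * v i) \<le> K"
      using V[OF 2(1)] \<open>K \<ge> 0\<close> by (simp add: norm2_scale mult_left_le)
    ultimately show ?thesis by blast
  qed
qed

text \<open>
  The hard instance as a finite family \<open>G\<close> of integrands with common minimal value \<open>b\<close>: every set
  \<open>S\<close> of at most half of the scenarios has a point that is optimal in each scenario of \<open>S\<close> but bad
  on average. For \<open>S\<close> this is \<open>R\<close> times its own code vector.
\<close>

lemma scenario_family:
  fixes R L :: real
  assumes "n \<ge> 2" "R > 0" "L > 0"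
  shows "\<exists>G :: nat \<Rightarrow> (nat \<Rightarrow> real) \<Rightarrow> real. \<exists>b.
     (\<forall>\<omega>. \<forall>x. \<exists>g. is_subgradient n (G \<omega>) x g \<and> norm2 n g \<le> L / 2) \<and>
     (\<forall>\<omega> x. b \<le> G \<omega> x) \<and> (\<forall>\<omega>. G \<omega> (\<lambda>i. 0) = b) \<and>
     (\<forall>S \<subseteq> {..<2 * n}. card S \<le> n \<longrightarrow>
        (\<exists>x\<in>B2 n R. (\<forall>\<omega>\<in>S. G \<omega> x = b) \<and>
           b + (1 - overlap) / 4 * L * R \<le> (\<Sum>\<omega><2 * n. G \<omega> x) / real (2 * n)))"
proof -
  define I where "I = {T. T \<subseteq> {..<2 * n} \<and> card T \<le> n}"
  have I: "finite I" "I \<subseteq> Pow {..<2 * n}" by (auto simp: I_def)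
  have "card I \<le> 4 ^ n"
    using card_mono[OF _ I(2)] by (simp add: card_Pow power_mult)
  then obtain v where v: "\<And>T. T \<in> I \<Longrightarrow> v T \<in> Rn n" "\<And>T. T \<in> I \<Longrightarrow> dot n (v T) (v T) = 1"
    "\<And>T T'. T \<in> I \<Longrightarrow> T' \<in> I \<Longrightarrow> T \<noteq> T' \<Longrightarrow> dot n (v T) (v T') \<le> overlap"
    using spherical_code[OF \<open>n \<ge> 2\<close> I(1)] by metis
  have norm_v: "norm2 n (v T) = 1" if "T \<in> I" for T
    using v(2)[OF that] norm2_power2[of n "v T"] norm2_nonneg[of n "v T"]
    by (simp add: power2_eq_1_iff)
  define V where "V \<omega> = v ` {T \<in> I. \<omega> \<notin> T}" for \<omega>
  have fin: "finite (V \<omega>)" for \<omega> using I(1) by (simp add: V_def)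
  define a where "a = overlap * R"
  define G where "G \<omega> x = L / 2 * floored_max n a (V \<omega>) x" for \<omega> x
  define b where "b = L / 2 * a"
  have a0: "a \<ge> 0" using overlap_bounds(1) \<open>R > 0\<close> by (simp add: a_def)
  have sub: "\<exists>g. is_subgradient n (G \<omega>) x g \<and> norm2 n g \<le> L / 2" for \<omega> x
    unfolding G_def using \<open>L > 0\<close> v(1) norm_v
    by (intro floored_max_subgradient fin) (auto simp: V_def)
  have low: "b \<le> G \<omega> x" for \<omega> x
    unfolding b_def G_def using \<open>L > 0\<close> floored_max_ge(1)[OF fin] by (intro mult_left_mono) auto
  have zero: "G \<omega> (\<lambda>i. 0) = b" for \<omega>
    unfolding b_def G_def using a0 by (subst floored_max_eq_floor[OF fin]) (auto simp: dot_def)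
  \<comment> \<open>Outside \<open>S\<close> the vector \<open>v S\<close> takes part in the maximum and lifts it from \<open>overlap * R\<close> to at
    least \<open>R\<close>; this is at least half of the scenarios, whence the quarter.\<close>
  have bad: "\<exists>x\<in>B2 n R. (\<forall>\<omega>\<in>S. G \<omega> x = b) \<and>
      b + (1 - overlap) / 4 * L * R \<le> (\<Sum>\<omega><2 * n. G \<omega> x) / real (2 * n)"
    if S: "S \<subseteq> {..<2 * n}" "card S \<le> n" for S
  proof -
    have "S \<in> I" using S by (simp add: I_def)
    define x where "x = (\<lambda>i. R * v S i)"
    have dot_x: "dot n u x = R * dot n u (v S)" for u
      by (simp add: dot_def x_def sum_distrib_left algebra_simps)
    have "x \<in> B2 n R"
      using v(1)[OF \<open>S \<in> I\<close>] norm_v[OF \<open>S \<in> I\<close>] \<open>R > 0\<close>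
      unfolding B2_def x_def by (simp add: norm2_scale) (simp add: topspace_Euclidean_space)
    moreover have "G \<omega> x = b" if "\<omega> \<in> S" for \<omega>
    proof -
      have "dot n u x \<le> a" if "u \<in> V \<omega>" for u
      proof -
        obtain T where T: "T \<in> I" "\<omega> \<notin> T" "u = v T" using \<open>u \<in> V \<omega>\<close> by (auto simp: V_def)
        then have "dot n u (v S) \<le> overlap" using v(3)[OF _ \<open>S \<in> I\<close>] \<open>\<omega> \<in> S\<close> by blast
        then show ?thesis using \<open>R > 0\<close> by (simp add: dot_x a_def mult.commute)
      qed
      then show ?thesis by (simp add: G_def b_def floored_max_eq_floor[OF fin])
    qed
    moreover have "b + (1 - overlap) / 4 * L * R \<le> (\<Sum>\<omega><2 * n. G \<omega> x) / real (2 * n)"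
    proof -
      define d where "d = L / 2 * ((1 - overlap) * R)"
      have d: "d \<ge> 0" using overlap_bounds(2) \<open>L > 0\<close> \<open>R > 0\<close> by (simp add: d_def)
      have "b + d \<le> G \<omega> x" if "\<omega> \<notin> S" for \<omega>
      proof -
        have "v S \<in> V \<omega>" using \<open>S \<in> I\<close> that by (auto simp: V_def)
        then have "R \<le> floored_max n a (V \<omega>) x"
          using floored_max_ge(2)[OF fin, of "v S" \<omega> n x a] v(2)[OF \<open>S \<in> I\<close>] by (simp add: dot_x)
        then have "L / 2 * R \<le> G \<omega> x" unfolding G_def using \<open>L > 0\<close> by (intro mult_left_mono) auto
        then show ?thesis by (simp add: b_def d_def a_def field_simps)
      qed
      then have "(\<Sum>\<omega><2 * n. b + (if \<omega> \<in> S then 0 else d)) \<le> (\<Sum>\<omega><2 * n. G \<omega> x)"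
        using low by (intro sum_mono) auto
      moreover have "(\<Sum>\<omega><2 * n. b + (if \<omega> \<in> S then 0 else d))
          = real (2 * n) * b + real (card ({..<2 * n} - S)) * d"
        by (simp add: sum.distrib sum.If_cases Diff_eq)
      moreover have "real n * d \<le> real (card ({..<2 * n} - S)) * d"
        using S d by (intro mult_right_mono) (auto simp: card_Diff_subset finite_subset)
      ultimately have "real (2 * n) * b + real n * d \<le> (\<Sum>\<omega><2 * n. G \<omega> x)" by linarith
      then have "b + d / 2 \<le> (\<Sum>\<omega><2 * n. G \<omega> x) / real (2 * n)"
        using \<open>n \<ge> 2\<close> by (simp add: field_simps)
      then show ?thesis by (simp add: d_def mult_ac)
    qed
    ultimately show ?thesis by blast
  qed
  show ?thesis
    by (intro exI[of _ G] exI[of _ b] conjI allI impI) (use sub low zero bad in auto)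
qed

theorem proposition2:
  shows "\<exists>c0::real. c0 > 0 \<and>
    (\<forall>(n::nat) (R::real) (L::real). n \<ge> 3 \<longrightarrow> R > 0 \<longrightarrow> L > 0 \<longrightarrow>
      (\<exists>(f :: (nat \<Rightarrow> real) \<Rightarrow> real) (m::nat) (P :: (nat \<Rightarrow> real) measure)
        (F :: (nat \<Rightarrow> real) \<Rightarrow> (nat \<Rightarrow> real) \<Rightarrow> real)
        (F' :: (nat \<Rightarrow> real) \<Rightarrow> (nat \<Rightarrow> real) \<Rightarrow> (nat \<Rightarrow> real))
        (f' :: (nat \<Rightarrow> real) \<Rightarrow> (nat \<Rightarrow> real)).
          convex_on (Rn n) f \<and> lipschitz2_on n L (B2 n R) f \<and>
          vector_law m P \<and>
          (\<forall>\<xi>\<in>space P. convex_on (Rn n) (\<lambda>x. F x \<xi>)) \<and>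
          (\<forall>x\<in>B2 n R. integrable P (F x) \<and> (\<integral>\<xi>. F x \<xi> \<partial>P) = f x) \<and>
          (\<forall>x\<in>B2 n R. is_subgradient n f x (f' x) \<and>
            (\<forall>\<xi>\<in>space P. is_subgradient n (\<lambda>y. F y \<xi>) x (F' x \<xi>)) \<and>
            (AE \<xi> in P. (norm2 n (F' x \<xi> - f' x))\<^sup>2 \<le> L\<^sup>2)) \<and>
          (\<forall>N::nat. 1 \<le> N \<longrightarrow> N \<le> n \<longrightarrow>
            \<P>(\<xi>s in (\<Pi>\<^sub>M i\<in>{..<N}. P).
                \<exists>x. is_arg_min (sample_average F N \<xi>s) (\<lambda>x. x \<in> B2 n R) x \<and>
                    f x - (INF y\<in>B2 n R. f y) \<ge> c0 * L * R) \<ge> 1 - exp (-1))))"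
proof (intro exI[of _ "(1 - overlap) / 4"] conjI allI impI)
  show "(1 - overlap) / 4 > 0" using overlap_bounds(2) by simp
  fix n :: nat and R L :: real
  assume "n \<ge> 3" and pos: "R > 0" "L > 0"
  define k where "k = 2 * n"
  have "k > 0" "n \<ge> 2" using \<open>n \<ge> 3\<close> by (auto simp: k_def)
  obtain G :: "nat \<Rightarrow> (nat \<Rightarrow> real) \<Rightarrow> real" and b where
    sub: "\<And>\<omega> x. \<exists>g. is_subgradient n (G \<omega>) x g \<and> norm2 n g \<le> L / 2"
    and low: "\<And>\<omega> x. b \<le> G \<omega> x" and zero: "\<And>\<omega>. G \<omega> (\<lambda>i. 0) = b"
    and bad: "\<And>S. S \<subseteq> {..<k} \<Longrightarrow> card S \<le> n \<Longrightarrow>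
        \<exists>x\<in>B2 n R. (\<forall>\<omega>\<in>S. G \<omega> x = b) \<and>
          b + (1 - overlap) / 4 * L * R \<le> (\<Sum>\<omega><k. G \<omega> x) / real k"
    using scenario_family[OF \<open>n \<ge> 2\<close> pos] unfolding k_def by metis
  obtain g where g: "\<And>\<omega> x. is_subgradient n (G \<omega>) x (g \<omega> x)" "\<And>\<omega> x. norm2 n (g \<omega> x) \<le> L / 2"
    using sub by metis
  define f where "f x = (\<Sum>\<omega><k. G \<omega> x) / real k" for x
  define f' where "f' x = (\<lambda>i. (\<Sum>\<omega><k. g \<omega> x i) / real k)" for x
  define F where "F x \<xi> = G (scenario k \<xi>) x" for x \<xi>
  define F' where "F' x \<xi> = g (scenario k \<xi>) x" for x \<xi>
  have sub_f: "is_subgradient n f x (f' x)" for x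
    unfolding f_def f'_def by (intro is_subgradient_average g(1))
  have norm_f': "norm2 n (f' x) \<le> L / 2" for x
    unfolding f'_def by (intro norm2_average_le \<open>k > 0\<close> g(2))
  have sub_F: "is_subgradient n (\<lambda>y. F y \<xi>) x (F' x \<xi>)" for x \<xi>
    unfolding F_def F'_def by (rule g(1))
  have dist: "(norm2 n (F' x \<xi> - f' x))\<^sup>2 \<le> L\<^sup>2" for x \<xi>
  proof -
    have "norm2 n (F' x \<xi> - f' x) \<le> L"
      using norm2_diff_le[of n "F' x \<xi>" "f' x"] norm_f'[of x] g(2)[of "scenario k \<xi>" x]
      unfolding F'_def by linarith
    then show ?thesis using norm2_nonneg by (rule power_mono)
  qed
  have lip: "lipschitz2_on n L (B2 n R) f"
  proof (rule lipschitz2_on_if_subgradients)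
    show "B2 n R \<subseteq> Rn n" by (auto simp: B2_def)
    show "\<exists>g. is_subgradient n f x g \<and> norm2 n g \<le> L" for x
      using sub_f[of x] norm_f'[of x] \<open>L > 0\<close> by (intro exI[of _ "f' x"]) auto
  qed
  have Opt: "(INF y\<in>B2 n R. f y) \<le> b"
  proof -
    have "b \<le> f x" for x
      unfolding f_def using \<open>k > 0\<close> sum_bounded_below[of "{..<k}" b "\<lambda>\<omega>. G \<omega> x"] low
      by (simp add: field_simps)
    then have "bdd_below (f ` B2 n R)" by (intro bdd_belowI) auto
    moreover have "(\<lambda>i. 0) \<in> B2 n R"
      using \<open>R > 0\<close> by (simp add: B2_def topspace_Euclidean_space norm2_def L2_set_def)
    ultimately have "(INF y\<in>B2 n R. f y) \<le> f (\<lambda>i. 0)" by (rule cINF_lower)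
    also have "\<dots> = b" using zero \<open>k > 0\<close> by (simp add: f_def)
    finally show ?thesis .
  qed
  \<comment> \<open>Repeated observations only make the set \<open>S\<close> of observed scenarios smaller, so the bound
    holds for every sample.\<close>
  have erm: "\<exists>x. is_arg_min (sample_average F N \<xi>s) (\<lambda>x. x \<in> B2 n R) x \<and>
      f x - (INF y\<in>B2 n R. f y) \<ge> (1 - overlap) / 4 * L * R"
    if "1 \<le> N" "N \<le> n" for N \<xi>s
  proof -
    define S where "S = (\<lambda>i. scenario k (\<xi>s i)) ` {..<N}"
    have "S \<subseteq> {..<k}" using scenario_less[OF \<open>k > 0\<close>] by (auto simp: S_def)
    moreover have "card S \<le> n"
      using card_image_le[of "{..<N}" "\<lambda>i. scenario k (\<xi>s i)"] \<open>N \<le> n\<close> by (simp add: S_def)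
    ultimately obtain x where x: "x \<in> B2 n R" "\<And>\<omega>. \<omega> \<in> S \<Longrightarrow> G \<omega> x = b"
      "b + (1 - overlap) / 4 * L * R \<le> f x"
      using bad unfolding f_def by meson
    have "sample_average F N \<xi>s x \<le> sample_average F N \<xi>s y" for y
      unfolding sample_average_def F_def using x(2) low
      by (intro mult_left_mono sum_mono) (auto simp: S_def)
    then have "is_arg_min (sample_average F N \<xi>s) (\<lambda>x. x \<in> B2 n R) x"
      using x(1) by (simp add: is_arg_min_def not_less)
    then show ?thesis using x(3) Opt by (intro exI[of _ x]) auto
  qed
  have prob: "\<P>(\<xi>s in (\<Pi>\<^sub>M i\<in>{..<N}. scenario_law k).
      \<exists>x. is_arg_min (sample_average F N \<xi>s) (\<lambda>x. x \<in> B2 n R) x \<and>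
          f x - (INF y\<in>B2 n R. f y) \<ge> (1 - overlap) / 4 * L * R) \<ge> 1 - exp (-1)"
    if N: "1 \<le> N" "N \<le> n" for N
  proof -
    have "prob_space (scenario_law k)"
      using vector_law_scenario_law by (simp add: vector_law_def)
    then have "prob_space (\<Pi>\<^sub>M i\<in>{..<N}. scenario_law k)" by (intro prob_space_PiM)
    then show ?thesis using erm[OF N] by (simp add: prob_space.prob_space)
  qed
  show "\<exists>f m P F F' f'.
          convex_on (Rn n) f \<and> lipschitz2_on n L (B2 n R) f \<and>
          vector_law m P \<and>
          (\<forall>\<xi>\<in>space P. convex_on (Rn n) (\<lambda>x. F x \<xi>)) \<and>
          (\<forall>x\<in>B2 n R. integrable P (F x) \<and> (\<integral>\<xi>. F x \<xi> \<partial>P) = f x) \<and>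
          (\<forall>x\<in>B2 n R. is_subgradient n f x (f' x) \<and>
            (\<forall>\<xi>\<in>space P. is_subgradient n (\<lambda>y. F y \<xi>) x (F' x \<xi>)) \<and>
            (AE \<xi> in P. (norm2 n (F' x \<xi> - f' x))\<^sup>2 \<le> L\<^sup>2)) \<and>
          (\<forall>N::nat. 1 \<le> N \<longrightarrow> N \<le> n \<longrightarrow>
            \<P>(\<xi>s in (\<Pi>\<^sub>M i\<in>{..<N}. P).
                \<exists>x. is_arg_min (sample_average F N \<xi>s) (\<lambda>x. x \<in> B2 n R) x \<and>
                    f x - (INF y\<in>B2 n R. f y) \<ge> (1 - overlap) / 4 * L * R) \<ge> 1 - exp (-1))"
  proof (intro exI[of _ f] exI[of _ "1::nat"] exI[of _ "scenario_law k"] exI[of _ F] exI[of _ F']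
      exI[of _ f'] conjI ballI allI impI)
    show "convex_on (Rn n) f" using sub_f by (intro convex_on_if_subgradients) blast
    show "convex_on (Rn n) (\<lambda>x. F x \<xi>)" for \<xi> using sub_F by (intro convex_on_if_subgradients) blast
    show "integrable (scenario_law k) (F x)" for x
      unfolding F_def by (rule integrable_scenario_law[OF \<open>k > 0\<close>])
    show "(\<integral>\<xi>. F x \<xi> \<partial>scenario_law k) = f x" for x
      unfolding F_def f_def by (rule integral_scenario_law[OF \<open>k > 0\<close>])
  qed (use lip vector_law_scenario_law sub_f sub_F dist prob in auto)
qed

end
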